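(* Let $V:\mathbb{R}^d\to\mathbb{R}$ be continuously differentiable, bounded from below and coercive, and let $\overline{\nabla}V:\mathbb{R}^d\times\mathbb{R}^d\to\mathbb{R}^d$ be a discrete gradient of $V$. Let $0<c\le M<\infty$ be constants, let $(\tau_n)_{n\ge 0}$ be real numbers with $c\le\tau_n\le M$ for all $n$, and let $\{x_n\}_{n=0}^\infty\subset\mathbb{R}^d$ be a sequence generated by the discrete gradient method, i.e. $x_{n+1}-x_n=-\tau_n\overline{\nabla}V(x_n,x_{n+1})$ for all $n\ge 0$. 1. If $V$ is in addition convex, then $V$ has a (global) minimizer on $\mathbb{R}^d$, and every accumulation point of the sequence $\{x_n\}_{n=0}^\infty$ is a (global) minimizer of $V$. 2. If $V$ is in addition strictly convex, then the sequence converges to the unique minimizer of $V$: $V$ has exactly one minimizer $x_*$, so that $V(x_* )=\min_{x\in\mathbb{R}^d}V(x)$, and $\lim_{n\to\infty}x_n=x_*$.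
   Context: $\mathbb{R}^d$ carries the standard inner product $\langle\cdot,\cdot\rangle$ and its norm $\|\cdot\|$; $\nabla V$ is the usual gradient. Discrete gradient: for a continuously differentiable $V:\mathbb{R}^d\to\mathbb{R}$, a function $\overline{\nabla}V:\mathbb{R}^d\times\mathbb{R}^d\to\mathbb{R}^d$ is a discrete gradient of $V$ iff it is continuous and, for all $x,x'\in\mathbb{R}^d$, $\langle\overline{\nabla}V(x,x'),x'-x\rangle=V(x')-V(x)$ and $\overline{\nabla}V(x,x)=\nabla V(x)$. Coercive: $V(x_n)\to\infty$ whenever $\|x_n\|\to\infty$. Bounded from below: there is a constant $C$ with $C\le V(x)$ for all $x\in\mathbb{R}^d$. *)

theory Defs
  imports "HOL-Analysis.Analysis"
begin

text \<open>Only meaningful at points of differentiability; there \<open>GDERIV\<close> determines the vector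
  uniquely, see \<open>gradient_eqI\<close>.\<close>

definition gradient :: "('a::euclidean_space \<Rightarrow> real) \<Rightarrow> 'a \<Rightarrow> 'a" where
  "gradient V x = (THE D. GDERIV V x :> D)"

lemma gradient_eqI:
  assumes "GDERIV V x :> D"
  shows "gradient V x = D"
  unfolding gradient_def
proof (rule the_equality)
  show "GDERIV V x :> D" by (fact assms)
next
  fix E assume "GDERIV V x :> E"
  with assms have "(\<lambda>h. inner h E) = (\<lambda>h. inner h D)"
    unfolding gderiv_def by (rule has_derivative_unique[rotated])
  then show "E = D"
    by (metis inner_commute vector_eq_rdot)
qed

lemma differentiable_GDERIV_gradient:
  assumes "V differentiable (at x)"
  shows "GDERIV V x :> gradient V x"
proof -
  from assms obtain f' where f': "(V has_derivative f') (at x)"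
    unfolding differentiable_def by blast
  then have "linear f'" by (rule has_derivative_linear)
  then have "f' = (\<lambda>h. inner h (adjoint f' 1))"
    by (auto simp: adjoint_works)
  with f' have "GDERIV V x :> adjoint f' 1"
    unfolding gderiv_def by simp
  then show ?thesis
    by (simp add: gradient_eqI)
qed

definition continuously_differentiable :: "('a::euclidean_space \<Rightarrow> real) \<Rightarrow> bool" where
  "continuously_differentiable V \<longleftrightarrow>
     (\<forall>x. V differentiable (at x)) \<and> continuous_on UNIV (gradient V)"

definition discrete_gradient ::
  "('a::euclidean_space \<Rightarrow> real) \<Rightarrow> ('a \<times> 'a \<Rightarrow> 'a) \<Rightarrow> bool" where
  "discrete_gradient V DV \<longleftrightarrow>
     continuous_on UNIV DV \<and>
     (\<forall>x x'. inner (DV (x, x')) (x' - x) = V x' - V x) \<and>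
     (\<forall>x. DV (x, x) = gradient V x)"

definition coercive :: "('a::real_normed_vector \<Rightarrow> real) \<Rightarrow> bool" where
  "coercive V \<longleftrightarrow>
     (\<forall>u :: nat \<Rightarrow> 'a. filterlim (\<lambda>n. norm (u n)) at_top sequentially \<longrightarrow>
        filterlim (\<lambda>n. V (u n)) at_top sequentially)"

definition strictly_convex_on :: "'a::real_vector set \<Rightarrow> ('a \<Rightarrow> real) \<Rightarrow> bool" where
  "strictly_convex_on S f \<longleftrightarrow> convex S \<and>
     (\<forall>x\<in>S. \<forall>y\<in>S. \<forall>u>0. \<forall>v>0. x \<noteq> y \<longrightarrow> u + v = 1 \<longrightarrow>
        f (u *\<^sub>R x + v *\<^sub>R y) < u * f x + v * f y)"

text \<open>Accumulation points of the sequence, not of its range: the value of an eventually constant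
  sequence is one, although it is no \<open>islimpt\<close> of the range.\<close>

definition accumulation_point :: "(nat \<Rightarrow> 'a::topological_space) \<Rightarrow> 'a \<Rightarrow> bool" where
  "accumulation_point x a \<longleftrightarrow>
     (\<exists>r :: nat \<Rightarrow> nat. strict_mono r \<and> (x \<circ> r) \<longlonglongrightarrow> a)"

end

theory Submission
  imports Defs
begin

text \<open>The discrete gradient identity turns each step into the energy balance
  \<open>V x\<^sub>n - V x\<^sub>n\<^sub>+\<^sub>1 = \<parallel>x\<^sub>n\<^sub>+\<^sub>1 - x\<^sub>n\<parallel>\<^sup>2 / \<tau>\<^sub>n\<close>. As \<open>V\<close> is bounded below and \<open>\<tau>\<^sub>n \<le> M\<close>, the increments tend to
  zero, and since \<open>\<tau>\<^sub>n \<ge> c\<close> so do the discrete gradients. By continuity the gradient of \<open>V\<close>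
  vanishes at every accumulation point, which by convexity is then a minimizer. Coercivity makes
  sublevel sets compact, so minimizers exist and, if there is only one, the
  whole sequence converges to it.\<close>

text \<open>If the set were unbounded, choosing its \<open>n\<close>-th point with norm above
  \<open>n\<close> would give a sequence escaping to infinity along which \<open>V\<close> stays at
  most \<open>b\<close>, against coercivity.\<close>

lemma coercive_compact_sublevel:
  fixes V :: "'a::euclidean_space \<Rightarrow> real"
  assumes "coercive V" "continuous_on UNIV V"
  shows "compact {y. V y \<le> b}"
proof -
  have "bounded {y. V y \<le> b}"
  proof (rule ccontr)
    assume "\<not> bounded {y. V y \<le> b}"
    then have "\<forall>n::nat. \<exists>y. V y \<le> b \<and> real n < norm y"
      unfolding bounded_iff by (auto simp: not_le)
    then obtain u where u: "\<And>n. V (u n) \<le> b" "\<And>n. real n < norm (u n)"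
      by metis
    have "filterlim (\<lambda>n. norm (u n)) at_top sequentially"
      by (rule filterlim_at_top_mono[OF filterlim_real_sequentially])
        (use u(2) in \<open>auto intro!: always_eventually less_imp_le\<close>)
    with assms(1) have "filterlim (\<lambda>n. V (u n)) at_top sequentially"
      by (auto simp: coercive_def)
    then have "eventually (\<lambda>n. b + 1 \<le> V (u n)) sequentially"
      by (auto simp: filterlim_at_top)
    then obtain n where "b + 1 \<le> V (u n)"
      by (auto simp: eventually_sequentially)
    with u(1)[of n] show False by simp
  qed
  moreover have "closed {y. V y \<le> b}"
    using assms(2) by (intro closed_Collect_le) auto
  ultimately show ?thesis by (simp add: compact_eq_bounded_closed)
qed

lemma coercive_attains_min:
  fixes V :: "'a::euclidean_space \<Rightarrow> real"
  assumes "coercive V" "continuous_on UNIV V"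
  shows "\<exists>a. \<forall>y. V a \<le> V y"
proof -
  let ?K = "{y. V y \<le> V 0}"
  have "compact ?K" "?K \<noteq> {}" "continuous_on ?K V"
    using coercive_compact_sublevel[OF assms] continuous_on_subset[OF assms(2)] by auto
  from continuous_attains_inf[OF this]
  obtain a where a: "a \<in> ?K" "\<And>y. y \<in> ?K \<Longrightarrow> V a \<le> V y"
    by auto
  \<comment> \<open>Outside \<open>?K\<close> the value exceeds \<open>V 0\<close>, which is at
    least \<open>V a\<close>, so the minimum over \<open>?K\<close> is global.\<close>
  have "V a \<le> V y" for y
    using a(2)[of y] a(1) by (cases "V y \<le> V 0") auto
  then show ?thesis by (intro exI allI)
qed

text \<open>On the segment from \<open>a\<close> to \<open>y\<close>, convexity bounds the
  difference quotients at \<open>a\<close> by \<open>V y - V a\<close>. They tend to the directional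
  derivative, which is zero.\<close>

lemma convex_critical_point_is_min:
  fixes V :: "'a::real_inner \<Rightarrow> real"
  assumes "convex_on UNIV V" "GDERIV V a :> 0"
  shows "V a \<le> V y"
proof -
  let ?g = "\<lambda>t. V (a + t *\<^sub>R (y - a))"
  have V: "(V has_derivative (\<lambda>h. 0)) (at (a + 0 *\<^sub>R (y - a)))"
    using assms(2) by (simp add: gderiv_def)
  have "((\<lambda>t. a + t *\<^sub>R (y - a)) has_derivative (\<lambda>t. t *\<^sub>R (y - a))) (at 0)"
    by (auto intro!: derivative_eq_intros)
  from has_derivative_compose[OF this V] have "(?g has_derivative (\<lambda>h. 0)) (at 0)"
    by simp
  then have "(?g has_field_derivative 0) (at 0)"
    by (simp add: has_field_derivative_def lambda_zero)
  then have "((\<lambda>h. (?g h - ?g 0) / h) \<longlongrightarrow> 0) (at 0)"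
    by (simp add: DERIV_def)
  \<comment> \<open>The limit is restricted to positive \<open>h\<close> because the convexity bound
    is divided by \<open>h\<close> and needs \<open>a + h *\<^sub>R (y - a)\<close> to lie between
    \<open>a\<close> and \<open>y\<close>.\<close>
  then have lim: "((\<lambda>h. (?g h - ?g 0) / h) \<longlongrightarrow> 0) (at_right 0)"
    by (rule tendsto_mono[rotated]) (simp add: at_le)
  have "eventually (\<lambda>h. (?g h - ?g 0) / h \<le> V y - V a) (at_right 0)"
    unfolding eventually_at_right_field
  proof (intro exI[of _ 1] conjI allI impI)
    fix h :: real assume h: "0 < h" "h < 1"
    have "?g h = V ((1 - h) *\<^sub>R a + h *\<^sub>R y)"
      by (simp add: algebra_simps)
    also have "\<dots> \<le> (1 - h) * V a + h * V y"
      using assms(1) h by (intro convex_onD) auto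
    finally show "(?g h - ?g 0) / h \<le> V y - V a"
      using h by (simp add: field_simps)
  qed simp
  with lim have "0 \<le> V y - V a"
    by (intro tendsto_upperbound) auto
  then show ?thesis by simp
qed

lemma strictly_convex_on_imp_convex_on:
  assumes "strictly_convex_on S f"
  shows "convex_on S f"
proof (rule convex_onI)
  show "convex S" using assms by (simp add: strictly_convex_on_def)
next
  fix t x y assume h: "0 < t" "t < (1::real)" "x \<in> S" "y \<in> S"
  show "f ((1 - t) *\<^sub>R x + t *\<^sub>R y) \<le> (1 - t) * f x + t * f y"
  \<comment> \<open>Strict convexity gives nothing at equal points, but there both sides
    coincide.\<close>
  proof (cases "x = y")
    case True
    then show ?thesis by (simp flip: scaleR_add_left distrib_right)
  next
    case False
    with assms h have "f ((1 - t) *\<^sub>R x + t *\<^sub>R y) < (1 - t) * f x + t * f y"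
      unfolding strictly_convex_on_def by simp
    then show ?thesis by simp
  qed
qed

text \<open>The midpoint of two distinct minimizers would have a value strictly below the
  minimum.\<close>

lemma strictly_convex_min_unique:
  fixes V :: "'a::real_vector \<Rightarrow> real"
  assumes "strictly_convex_on UNIV V" "\<And>y. V a \<le> V y" "\<And>y. V b \<le> V y"
  shows "a = b"
proof (rule ccontr)
  assume "a \<noteq> b"
  with assms(1) have "u + v = 1 \<Longrightarrow> V (u *\<^sub>R a + v *\<^sub>R b) < u * V a + v * V b"
    if "0 < u" "0 < v" for u v
    using that by (simp add: strictly_convex_on_def)
  from this[of "1/2" "1/2"]
  have "V ((1/2) *\<^sub>R a + (1/2) *\<^sub>R b) < 1/2 * V a + 1/2 * V b"
    by simp
  with assms(2)[of b] assms(3)[of a] assms(2)[of "(1/2) *\<^sub>R a + (1/2) *\<^sub>R b"]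
  show False by simp
qed

text \<open>Without convergence some subsequence stays at distance at least \<open>e\<close> from
  \<open>a\<close>. By compactness a further subsequence converges, and its limit is an accumulation
  point of \<open>x\<close>, hence \<open>a\<close>, which is impossible.\<close>

lemma tendsto_unique_accumulation_point:
  fixes x :: "nat \<Rightarrow> 'a::metric_space"
  assumes "compact K" "\<And>n. x n \<in> K" "\<And>b. accumulation_point x b \<Longrightarrow> b = a"
  shows "x \<longlonglongrightarrow> a"
proof (rule ccontr)
  assume "\<not> x \<longlonglongrightarrow> a"
  then obtain e where e: "e > 0" "\<not> eventually (\<lambda>n. dist (x n) a < e) sequentially"
    by (auto simp: tendsto_iff)
  then have "infinite {n. e \<le> dist (x n) a}"
    by (simp add: not_eventually frequently_cofinite not_less flip: cofinite_eq_sequentially)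
  then obtain r :: "nat \<Rightarrow> nat" where r: "strict_mono r" "\<And>n. e \<le> dist (x (r n)) a"
    using infinite_enumerate by blast
  from assms(1,2) obtain l s where s: "strict_mono s" "((x \<circ> r) \<circ> s) \<longlonglongrightarrow> l"
    unfolding compact_def by (metis comp_apply)
  then have "accumulation_point x l"
    unfolding accumulation_point_def
    by (intro exI[of _ "r \<circ> s"]) (use r(1) in \<open>auto simp: comp_assoc strict_mono_o\<close>)
  with assms(3) s(2) have "(\<lambda>n. x (r (s n))) \<longlonglongrightarrow> a"
    by (auto simp: o_def)
  then have "eventually (\<lambda>n. dist (x (r (s n))) a < e) sequentially"
    using e(1) by (rule tendstoD)
  then show False
    using r(2) by (auto simp: eventually_sequentially not_less[symmetric])
qed

text \<open>Pair \<open>t *\<^sub>R DV (y, y')\<close> with \<open>y' - y\<close>: the discrete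
  gradient identity evaluates this as \<open>t * (V y' - V y)\<close>, the update rule as minus the
  squared length of the increment.\<close>

lemma discrete_gradient_step:
  fixes V :: "'a::euclidean_space \<Rightarrow> real"
  assumes "discrete_gradient V DV" "0 < t" "y' - y = - t *\<^sub>R DV (y, y')"
  shows "V y - V y' = (norm (y' - y))\<^sup>2 / t"
proof -
  have "t * (V y' - V y) = inner (t *\<^sub>R DV (y, y')) (y' - y)"
    using assms(1) by (simp add: discrete_gradient_def)
  also have "t *\<^sub>R DV (y, y') = - (y' - y)"
    using assms(3) by simp
  finally have "t * (V y' - V y) = - (norm (y' - y))\<^sup>2"
    by (simp only: inner_minus_left power2_norm_eq_inner)
  with assms(2) show ?thesis by (simp add: field_simps)
qed

lemma discrete_gradient_method_decseq:
  fixes V :: "'a::euclidean_space \<Rightarrow> real"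
  assumes "discrete_gradient V DV" "\<And>n. 0 < \<tau> n"
    and "\<And>n. x (Suc n) - x n = - \<tau> n *\<^sub>R DV (x n, x (Suc n))"
  shows "decseq (\<lambda>n. V (x n))"
proof (rule decseq_SucI)
  fix n
  have "0 \<le> V (x n) - V (x (Suc n))"
    using discrete_gradient_step[OF assms(1,2,3)] assms(2)[of n] by simp
  then show "V (x (Suc n)) \<le> V (x n)" by simp
qed

lemma discrete_gradient_method_increments:
  fixes V :: "'a::euclidean_space \<Rightarrow> real"
  assumes "discrete_gradient V DV" "bdd_below (range V)" "\<And>n. 0 < \<tau> n" "\<And>n. \<tau> n \<le> M"
    and "\<And>n. x (Suc n) - x n = - \<tau> n *\<^sub>R DV (x n, x (Suc n))"
  shows "(\<lambda>n. x (Suc n) - x n) \<longlonglongrightarrow> 0"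
proof -
  obtain B where B: "\<And>y. B \<le> V y"
    using assms(2) by (auto simp: bdd_below_def)
  obtain L where L: "(\<lambda>n. V (x n)) \<longlonglongrightarrow> L"
  proof (rule decseq_convergent)
    show "decseq (\<lambda>n. V (x n))"
      by (rule discrete_gradient_method_decseq[where \<tau> = \<tau>, OF assms(1,3,5)])
  qed (use B in auto)
  \<comment> \<open>Consecutive values of \<open>V\<close> share the limit \<open>L\<close>, so the
    energy drops vanish; scaled by \<open>M\<close> they dominate the squared increments.\<close>
  have "(\<lambda>n. M * (V (x n) - V (x (Suc n)))) \<longlonglongrightarrow> M * (L - L)"
    by (intro tendsto_intros L LIMSEQ_Suc)
  then have "(\<lambda>n. M * (V (x n) - V (x (Suc n)))) \<longlonglongrightarrow> 0" by simp
  then have "(\<lambda>n. (norm (x (Suc n) - x n))\<^sup>2) \<longlonglongrightarrow> 0"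
  proof (rule tendsto_sandwich[rotated 3, where f = "\<lambda>_. 0"])
    have "(norm (x (Suc n) - x n))\<^sup>2 \<le> M * (V (x n) - V (x (Suc n)))" for n
    proof -
      have eq: "V (x n) - V (x (Suc n)) = (norm (x (Suc n) - x n))\<^sup>2 / \<tau> n"
        by (rule discrete_gradient_step[OF assms(1,3,5)])
      then have "(norm (x (Suc n) - x n))\<^sup>2 = \<tau> n * (V (x n) - V (x (Suc n)))"
        using assms(3)[of n] by simp
      also have "\<dots> \<le> M * (V (x n) - V (x (Suc n)))"
        using assms(3,4)[of n] by (intro mult_right_mono) (auto simp: eq)
      finally show ?thesis .
    qed
    then show "eventually (\<lambda>n. (norm (x (Suc n) - x n))\<^sup>2 \<le> M * (V (x n) - V (x (Suc n)))) sequentially"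
      by simp
  qed auto
  then show ?thesis by (simp add: tendsto_norm_zero_iff)
qed

lemma discrete_gradient_method_accumulation_critical:
  fixes V :: "'a::euclidean_space \<Rightarrow> real"
  assumes "discrete_gradient V DV" "bdd_below (range V)"
    and "0 < c" "\<And>n. c \<le> \<tau> n" "\<And>n. \<tau> n \<le> M"
    and step: "\<And>n. x (Suc n) - x n = - \<tau> n *\<^sub>R DV (x n, x (Suc n))"
    and "accumulation_point x a"
  shows "gradient V a = 0"
proof -
  have pos: "0 < \<tau> n" for n using assms(3,4) less_le_trans by blast
  have d: "(\<lambda>n. x (Suc n) - x n) \<longlonglongrightarrow> 0"
    by (rule discrete_gradient_method_increments
        [where \<tau> = \<tau> and x = x, OF assms(1,2) pos assms(5) step])
  obtain r :: "nat \<Rightarrow> nat" where r: "strict_mono r" "(\<lambda>n. x (r n)) \<longlonglongrightarrow> a"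
    using assms(7) by (auto simp: accumulation_point_def o_def)
  have dr: "(\<lambda>n. x (Suc (r n)) - x (r n)) \<longlonglongrightarrow> 0"
    using LIMSEQ_subseq_LIMSEQ[OF d r(1)] by (simp add: o_def)
  \<comment> \<open>The successors follow the subsequence to the same limit, so the argument pairs
    of \<open>DV\<close> approach the diagonal, where \<open>DV\<close> is the gradient.\<close>
  have "(\<lambda>n. x (Suc (r n))) \<longlonglongrightarrow> a"
    using tendsto_add[OF dr r(2)] by simp
  then have "(\<lambda>n. (x (r n), x (Suc (r n)))) \<longlonglongrightarrow> (a, a)"
    by (intro tendsto_Pair r(2))
  then have "(\<lambda>n. DV (x (r n), x (Suc (r n)))) \<longlonglongrightarrow> DV (a, a)"
    using assms(1) unfolding discrete_gradient_def
    by (intro continuous_on_tendsto_compose[where s = UNIV and f = DV]) auto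
  moreover have "(\<lambda>n. DV (x (r n), x (Suc (r n)))) \<longlonglongrightarrow> 0"
  proof (rule Lim_null_comparison)
    show "(\<lambda>n. norm (x (Suc (r n)) - x (r n)) / c) \<longlonglongrightarrow> 0"
      using tendsto_divide_zero[OF tendsto_norm_zero[OF dr]] .
    \<comment> \<open>The lower bound on the step sizes turns small increments into small discrete
      gradients.\<close>
    have "c * norm (DV (x n, x (Suc n))) \<le> norm (x (Suc n) - x n)" for n
      using assms(4)[of n] pos[of n] by (simp add: step mult_right_mono)
    then show "eventually (\<lambda>n. norm (DV (x (r n), x (Suc (r n))))
        \<le> norm (x (Suc (r n)) - x (r n)) / c) sequentially"
      using assms(3) by (simp add: field_simps)
  qed
  ultimately have "DV (a, a) = 0" by (rule LIMSEQ_unique)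
  then show ?thesis using assms(1) by (simp add: discrete_gradient_def)
qed

theorem theorem3p3:
  fixes V :: "real ^ 'd \<Rightarrow> real"
    and DV :: "(real ^ 'd) \<times> (real ^ 'd) \<Rightarrow> real ^ 'd"
    and c M :: real
    and \<tau> :: "nat \<Rightarrow> real"
    and x :: "nat \<Rightarrow> real ^ 'd"
  assumes "continuously_differentiable V"
    and "bdd_below (range V)"
    and "coercive V"
    and "discrete_gradient V DV"
    and "0 < c" and "c \<le> M"
    and "\<forall>n. c \<le> \<tau> n \<and> \<tau> n \<le> M"
    and "\<forall>n. x (Suc n) - x n = - \<tau> n *\<^sub>R DV (x n, x (Suc n))"
  shows "(convex_on UNIV V \<longrightarrow>
            (\<exists>a. is_arg_min V (\<lambda>_. True) a) \<and>
            (\<forall>a. accumulation_point x a \<longrightarrow> is_arg_min V (\<lambda>_. True) a)) \<and>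
         (strictly_convex_on UNIV V \<longrightarrow>
            (\<exists>a. (\<forall>b. is_arg_min V (\<lambda>_. True) b \<longleftrightarrow> b = a) \<and> x \<longlonglongrightarrow> a))"
proof -
  \<comment> \<open>\<open>is_arg_min\<close> only forbids strictly smaller values; since the reals
    are linearly ordered, this is global minimality.\<close>
  have min_iff: "is_arg_min V (\<lambda>_. True) a \<longleftrightarrow> (\<forall>y. V a \<le> V y)" for a
    by (auto simp: is_arg_min_def not_less)
  have diff: "V differentiable (at y)" for y
    using assms(1) by (simp add: continuously_differentiable_def)
  then have cont: "continuous_on UNIV V"
    by (auto intro!: differentiable_imp_continuous_on
        simp: differentiable_on_def differentiable_at_withinI)
  have pos: "0 < \<tau> n" for n
    using assms(5,7) less_le_trans by blast
  have step: "x (Suc n) - x n = - \<tau> n *\<^sub>R DV (x n, x (Suc n))" for n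
    using assms(8) by blast
  obtain a where a: "\<And>y. V a \<le> V y"
    using coercive_attains_min[OF assms(3) cont] by blast
  have acc: "V b \<le> V y" if "convex_on UNIV V" "accumulation_point x b" for b y
  proof -
    have "gradient V b = 0"
      by (rule discrete_gradient_method_accumulation_critical
          [where \<tau> = \<tau> and M = M and x = x, OF assms(4,2,5) _ _ step that(2)])
        (use assms(7) in auto)
    with differentiable_GDERIV_gradient[OF diff, of b] show ?thesis
      by (intro convex_critical_point_is_min[OF that(1)]) simp
  qed
  have "x \<longlonglongrightarrow> a" if sc: "strictly_convex_on UNIV V"
  proof (rule tendsto_unique_accumulation_point)
    show "compact {y. V y \<le> V (x 0)}"
      by (rule coercive_compact_sublevel[OF assms(3) cont])
    \<comment> \<open>Energy decrease traps the iterates in the initial sublevel set.\<close>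
    show "x n \<in> {y. V y \<le> V (x 0)}" for n
      using decseqD[OF discrete_gradient_method_decseq
          [where \<tau> = \<tau> and x = x, OF assms(4) pos step], of 0 n] by simp
    show "b = a" if "accumulation_point x b" for b
      using strictly_convex_min_unique[OF sc]
        acc[OF strictly_convex_on_imp_convex_on[OF sc] that] a by blast
  qed
  moreover have "(\<forall>y. V b \<le> V y) \<longleftrightarrow> b = a" if "strictly_convex_on UNIV V" for b
    using strictly_convex_min_unique[OF that] a by blast
  ultimately show ?thesis
    unfolding min_iff using acc a by blast
qed

end
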